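(* For each fixed $\mu>0$, $$\beta^*(\mu,b_\infty)\ge\frac1N\,\frac{S_p^{N/p}}{\mu^{(N-p)/p}}+o(1)\quad\text{as }b_\infty\to0.$$ For each fixed $b_\infty>0$, $$\beta^*(\mu,b_\infty)\ge\frac1N\,\frac{(a_0S_q)^{N/q}}{b_\infty^{(N-q)/q}}+o(1)\quad\text{as }\mu\to0.$$
   Context: $N\ge2$, $1<p<q<N$ with $q/p\le N/(N-1)$; $p^*=Np/(N-p)$, $q^*=Nq/(N-q)$ (so $q<p^*<q^*$). $a_0>0$ is a fixed constant (in the paper, $a_0=\inf_{\operatorname{supp}(b)}a$), and $\mu,b_\infty\ge0$ are parameters. For $m\in\{p,q\}$, $S_m=\inf_{u\in\mathcal D^{1,m}(\mathbb R^N)\setminus\{0\}}\int_{\mathbb R^N}|\nabla u|^m\,dx\big/\big(\int_{\mathbb R^N}|u|^{m^*}dx\big)^{m/m^*}$, where $\mathcal D^{1,m}(\mathbb R^N)=\{u\in L^{m^*}(\mathbb R^N):|\nabla u|\in L^m(\mathbb R^N)\}$. Let $I(X,Y,Z,W)=\frac1pX+\frac1qY-\frac1{p^*}Z-\frac1{q^*}W$. $S(\mu,b_\infty)$ is the set of $(X,Y,Z,W)\in\mathbb R^4$ with $X,Y,Z,W\ge0$ satisfying $I(X,Y,Z,W)>0$, $X+Y=Z+W$, $Z\le\frac{\mu}{S_p^{p^*/p}}X^{p^*/p}$ and $W\le\frac{b_\infty}{(a_0S_q)^{q^*/q}}Y^{q^*/q}$. Then $\beta^*(\mu,b_\infty):=\inf_{(X,Y,Z,W)\in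 S(\mu,b_\infty)}I(X,Y,Z,W)$. *)

theory Defs
  imports "HOL-Analysis.Analysis" "HOL-Library.Landau_Symbols"
begin

primrec continuously_differentiable :: "nat \<Rightarrow> (real ^ 'n \<Rightarrow> real) \<Rightarrow> bool" where
  "continuously_differentiable 0 f \<longleftrightarrow> continuous_on UNIV f"
| "continuously_differentiable (Suc k) f \<longleftrightarrow>
     (\<forall>x. f differentiable (at x)) \<and>
     (\<forall>i. continuously_differentiable k (\<lambda>x. frechet_derivative f (at x) (axis i 1)))"

definition test_function :: "(real ^ 'n \<Rightarrow> real) \<Rightarrow> bool" where
  "test_function \<phi> \<longleftrightarrow>
     (\<forall>k. continuously_differentiable k \<phi>) \<and> compact (closure {x. \<phi> x \<noteq> 0})"

text \<open>The distributional gradient. Local integrability is required explicitly, so that all the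
  integrals below are genuine ones. Such a \<open>G\<close> is unique up to a null set.\<close>

definition has_weak_gradient :: "(real ^ 'n \<Rightarrow> real) \<Rightarrow> (real ^ 'n \<Rightarrow> real ^ 'n) \<Rightarrow> bool" where
  "has_weak_gradient u G \<longleftrightarrow>
     (\<forall>K. compact K \<longrightarrow> u absolutely_integrable_on K \<and> G absolutely_integrable_on K) \<and>
     (\<forall>\<phi> i. test_function \<phi> \<longrightarrow>
        (LINT x|lebesgue. u x * frechet_derivative \<phi> (at x) (axis i 1)) =
        - (LINT x|lebesgue. G x $ i * \<phi> x))"

definition weak_gradient :: "(real ^ 'n \<Rightarrow> real) \<Rightarrow> real ^ 'n \<Rightarrow> real ^ 'n" where
  "weak_gradient u = (SOME G. has_weak_gradient u G)"

definition Lebesgue_space :: "real \<Rightarrow> (real ^ 'n \<Rightarrow> 'b :: euclidean_space) set" where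
  "Lebesgue_space r = {f \<in> borel_measurable lebesgue. integrable lebesgue (\<lambda>x. norm (f x) powr r)}"

definition critical_exponent :: "nat \<Rightarrow> real \<Rightarrow> real" where
  "critical_exponent N m = real N * m / (real N - m)"

text \<open>Elements are functions rather than classes modulo almost everywhere equality; the zero
  element is accordingly excluded below by an almost everywhere condition.\<close>

definition D1_space :: "real \<Rightarrow> (real ^ 'n \<Rightarrow> real) set" where
  "D1_space m = {u \<in> Lebesgue_space (critical_exponent CARD('n) m).
     (\<exists>G. has_weak_gradient u G) \<and> weak_gradient u \<in> Lebesgue_space m}"

definition Sobolev_constant :: "'n::finite itself \<Rightarrow> real \<Rightarrow> real" where
  "Sobolev_constant _ m =
     (INF u \<in> {u :: real ^ 'n \<Rightarrow> real. u \<in> D1_space m \<and> \<not> (AE x in lebesgue. u x = 0)}.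
        (LINT x|lebesgue. norm (weak_gradient u x) powr m) /
        (LINT x|lebesgue. \<bar>u x\<bar> powr critical_exponent CARD('n) m)
          powr (m / critical_exponent CARD('n) m))"

definition energy :: "nat \<Rightarrow> real \<Rightarrow> real \<Rightarrow> real \<times> real \<times> real \<times> real \<Rightarrow> real" where
  "energy N p q = (\<lambda>(X, Y, Z, W).
     1 / p * X + 1 / q * Y - 1 / critical_exponent N p * Z - 1 / critical_exponent N q * W)"

definition constraint_set ::
  "'n::finite itself \<Rightarrow> real \<Rightarrow> real \<Rightarrow> real \<Rightarrow> real \<Rightarrow> real \<Rightarrow> (real \<times> real \<times> real \<times> real) set" where
  "constraint_set T p q a0 \<mu> b =
     {(X, Y, Z, W). X \<ge> 0 \<and> Y \<ge> 0 \<and> Z \<ge> 0 \<and> W \<ge> 0 \<and>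
        energy CARD('n) p q (X, Y, Z, W) > 0 \<and>
        X + Y = Z + W \<and>
        Z \<le> \<mu> / Sobolev_constant T p powr (critical_exponent CARD('n) p / p)
              * X powr (critical_exponent CARD('n) p / p) \<and>
        W \<le> b / (a0 * Sobolev_constant T q) powr (critical_exponent CARD('n) q / q)
              * Y powr (critical_exponent CARD('n) q / q)}"

text \<open>Extended real valued, so that the infimum over the empty set (which occurs for
  \<open>\<mu> = b = 0\<close>) is \<open>\<infinity>\<close>.\<close>

definition beta_star :: "'n::finite itself \<Rightarrow> real \<Rightarrow> real \<Rightarrow> real \<Rightarrow> real \<Rightarrow> real \<Rightarrow> ereal" where
  "beta_star T p q a0 \<mu> b = (INF v \<in> constraint_set T p q a0 \<mu> b. ereal (energy CARD('n) p q v))"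

end

theory Submission
  imports Defs
begin

text \<open>
  Put \<open>\<delta> = 1/p - 1/q\<close>. Since \<open>1/m - 1/m\<^sup>* = 1/N\<close> for \<open>m \<in> {p, q}\<close>, on the hyperplane
  \<open>X + Y = Z + W\<close> the energy equals \<open>(X + Y)/N + \<delta> (X - Z) = (X + Y)/N + \<delta> (W - Y)\<close>, and the
  hypothesis on \<open>q/p\<close> gives \<open>\<delta> < 1/N\<close>, so a bound on the energy bounds both \<open>X\<close> and \<open>Y\<close>.
  On a bounded set the superlinear constraint with the vanishing coefficient forces \<open>W < Y\<close>
  (respectively \<open>Z < X\<close>) unless both sides are zero. The other pair then satisfies the reverse
  inequality, and its own superlinear constraint bounds it from below by the asserted threshold.
  For small values of the vanishing parameter the asserted bound therefore holds without any
  error term. Positivity of the Sobolev constants is not needed: if the relevant one vanishes,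
  the asserted bound is zero.
\<close>

lemma one_div_critical_exponent:
  assumes "0 < m" "m < real N"
  shows "1 / critical_exponent N m = 1 / m - 1 / real N"
  using assms by (simp add: critical_exponent_def field_simps)

lemma critical_exponent_div:
  assumes "0 < m"
  shows "critical_exponent N m / m = real N / (real N - m)"
  using assms by (simp add: critical_exponent_def)

lemma energy_on_constraint:
  assumes "0 < p" "p < real N" "0 < q" "q < real N" and "X + Y = Z + W"
  shows "energy N p q (X, Y, Z, W) = (X + Y) / real N + (1 / p - 1 / q) * (X - Z)"
proof -
  have W: "W = X + Y - Z" using assms by simp
  show ?thesis
    unfolding energy_def split one_div_critical_exponent[OF assms(1,2)]
      one_div_critical_exponent[OF assms(3,4)] W
    by (simp add: algebra_simps add_divide_distrib diff_divide_distrib)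
qed

text \<open>Clearing denominators turns the ratio hypothesis into
  \<open>(q - p) * N \<le> q\<close>; strictness comes from \<open>q < p * q\<close>, that is, from
  \<open>1 < p\<close>.\<close>

lemma inverse_exponent_gap:
  assumes "1 < p" "p < q" "1 < N" "q / p \<le> N / (N - 1)"
  shows "1 / p - 1 / q < 1 / (N::real)"
proof -
  have "q * (N - 1) \<le> p * N" using assms by (simp add: field_simps)
  moreover have "q < p * q" using assms by simp
  ultimately have "(q - p) * N < p * q" by (simp add: algebra_simps)
  then show ?thesis using assms by (simp add: field_simps)
qed

text \<open>Dividing by \<open>y > 0\<close> leaves the power \<open>m / (N - m)\<close> of
  \<open>y\<close> on the right; raising to the reciprocal power \<open>(N - m) / m\<close> isolates
  \<open>y\<close>.\<close>

lemma superlinear_threshold: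
  fixes N m s c y :: real
  assumes "0 < m" "m < N" "s \<noteq> 0" "0 < c" "0 < y"
    and le: "y \<le> c / s powr (N / (N - m)) * y powr (N / (N - m))"
  shows "s powr (N / m) / c powr ((N - m) / m) \<le> y"
proof -
  have e: "y powr (N / (N - m)) = y * y powr (m / (N - m))"
    using assms powr_add[of y 1 "m / (N - m)"] by (simp add: field_simps)
  have "s powr (N / (N - m)) / c \<le> y powr (m / (N - m))"
    using le assms unfolding e by (simp add: field_simps)
  then have "(s powr (N / (N - m)) / c) powr ((N - m) / m)
      \<le> (y powr (m / (N - m))) powr ((N - m) / m)"
    using assms by (intro powr_mono2) auto
  then show ?thesis using assms by (simp add: powr_powr powr_divide)
qed

text \<open>After division by \<open>y\<close> the left side is nondecreasing in \<open>y\<close>,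
  so its value at \<open>C\<close> controls all smaller \<open>y\<close> at once, and that value
  tends to 0 with \<open>c\<close>.\<close>

lemma eventually_superlinear_less:
  fixes \<alpha> B C :: real
  assumes "1 < \<alpha>" "0 \<le> B"
  shows "\<forall>\<^sub>F c in at_right 0. \<forall>y. 0 < y \<and> y \<le> C \<longrightarrow> c / B * y powr \<alpha> < y"
proof -
  have "((\<lambda>c. c * (C powr (\<alpha> - 1) / B)) \<longlongrightarrow> 0) (at_right 0)"
    by (intro tendsto_mult_left_zero tendsto_ident_at)
  then have "((\<lambda>c. c / B * C powr (\<alpha> - 1)) \<longlongrightarrow> 0) (at_right 0)"
    by simp
  then have "\<forall>\<^sub>F c in at_right 0. c / B * C powr (\<alpha> - 1) < 1"
    by (rule order_tendstoD) simp
  moreover have "\<forall>\<^sub>F c::real in at_right 0. 0 < c"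
    by (simp add: eventually_at_right_less)
  ultimately show ?thesis
  proof eventually_elim
    case (elim c)
    show ?case
    proof (intro allI impI)
      fix y assume y: "0 < y \<and> y \<le> C"
      have "c / B * y powr (\<alpha> - 1) \<le> c / B * C powr (\<alpha> - 1)"
        using y elim assms by (intro mult_left_mono powr_mono2) auto
      then have "c / B * y powr (\<alpha> - 1) * y < 1 * y"
        using y elim by (intro mult_strict_right_mono) auto
      moreover have "y powr \<alpha> = y powr (\<alpha> - 1) * y"
        using y powr_add[of y "\<alpha> - 1" 1] by simp
      ultimately show "c / B * y powr \<alpha> < y" by (simp add: mult.assoc)
    qed
  qed
qed

text \<open>Smallness gives \<open>Z \<le> X\<close>, hence \<open>Y \<le> W\<close> by the balance.
  If \<open>Y = 0\<close>, then \<open>W \<le> 0\<close> and \<open>X \<le> Z < X\<close>.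
  Coefficients and exponents are left abstract so that the two pairs can exchange roles.\<close>

lemma dominated_pair:
  fixes X Y Z W :: real
  assumes "0 \<le> X" "0 \<le> Y" "X + Y = Z + W" "X \<noteq> 0 \<or> Y \<noteq> 0"
    and Z: "Z \<le> c * X powr \<alpha>" and W: "W \<le> d * Y powr \<gamma>"
    and small: "0 < X \<Longrightarrow> c * X powr \<alpha> < X"
  shows "Z \<le> X" "0 < Y" "Y \<le> d * Y powr \<gamma>"
proof -
  show ZX: "Z \<le> X" using assms by (cases "X = 0") auto
  show "0 < Y"
  proof (rule ccontr)
    assume "\<not> 0 < Y"
    then have "Y = 0" "W \<le> 0" "0 < X" using assms by auto
    then show False using assms small by auto
  qed
  show "Y \<le> d * Y powr \<gamma>" using ZX assms by linarith
qed

theorem proposition2p9: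
  fixes N :: nat and p q a0 :: real
  assumes "N = CARD('n::finite)" and "N \<ge> 2"
    and "1 < p" and "p < q" and "q < real N"
    and "q / p \<le> real N / (real N - 1)"
    and "a0 > 0"
  shows "(\<forall>\<mu>>0. \<exists>r :: real \<Rightarrow> real. r \<in> o[at_right 0](\<lambda>_. 1) \<and>
            (\<forall>\<^sub>F b in at_right 0.
               beta_star TYPE('n) p q a0 \<mu> b \<ge>
                 ereal (1 / real N * (Sobolev_constant TYPE('n) p powr (real N / p)
                          / \<mu> powr ((real N - p) / p)) + r b)))
       \<and> (\<forall>b>0. \<exists>r :: real \<Rightarrow> real. r \<in> o[at_right 0](\<lambda>_. 1) \<and>
            (\<forall>\<^sub>F \<mu> in at_right 0.
               beta_star TYPE('n) p q a0 \<mu> b \<ge>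
                 ereal (1 / real N * ((a0 * Sobolev_constant TYPE('n) q) powr (real N / q)
                          / b powr ((real N - q) / q)) + r \<mu>)))"
proof -
  have N: "1 < real N" and p: "0 < p" "p < real N" and q: "0 < q" "q < real N" using assms by auto
  define \<delta> where "\<delta> = 1 / p - 1 / q"
  have \<delta>: "0 \<le> \<delta>" "\<delta> < 1 / real N"
    using inverse_exponent_gap[of p q "real N"] assms p q by (auto simp: \<delta>_def field_simps)
  have exps: "1 < real N / (real N - p)" "1 < real N / (real N - q)" using p q by auto
  define Sp where "Sp = Sobolev_constant TYPE('n) p"
  define Sq where "Sq = a0 * Sobolev_constant TYPE('n) q"
  define K where "K \<mu> = \<mu> / Sp powr (real N / (real N - p))" for \<mu>
  define L where "L b = b / Sq powr (real N / (real N - q))" for b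
  define Tp where "Tp \<mu> = 1 / real N * (Sp powr (real N / p) / \<mu> powr ((real N - p) / p))" for \<mu>
  define Tq where "Tq b = 1 / real N * (Sq powr (real N / q) / b powr ((real N - q) / q))" for b
  \<comment> \<open>A bound on the infimum reduces to a pointwise bound away from
    \<open>X = Y = 0\<close>.\<close>
  have beta_ge: "beta_star TYPE('n) p q a0 \<mu> b \<ge> ereal T"
    if H: "\<And>X Y Z W E. \<lbrakk>0 \<le> X; 0 \<le> Y; X + Y = Z + W; X \<noteq> 0 \<or> Y \<noteq> 0;
        Z \<le> K \<mu> * X powr (real N / (real N - p)); W \<le> L b * Y powr (real N / (real N - q));
        0 \<le> W; 0 < E; E = (X + Y) / real N + \<delta> * (X - Z)\<rbrakk> \<Longrightarrow> T \<le> E" for \<mu> b T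
    unfolding beta_star_def
  proof (rule INF_greatest)
    fix v assume "v \<in> constraint_set TYPE('n) p q a0 \<mu> b"
    moreover obtain X Y Z W where v: "v = (X, Y, Z, W)" by (cases v) auto
    ultimately have c: "0 \<le> X" "0 \<le> Y" "0 \<le> Z" "0 \<le> W" "0 < energy N p q v" "X + Y = Z + W"
        "Z \<le> K \<mu> * X powr (real N / (real N - p))" "W \<le> L b * Y powr (real N / (real N - q))"
      by (auto simp: constraint_set_def K_def L_def Sp_def Sq_def assms(1)[symmetric]
          critical_exponent_div p q)
    have E: "energy N p q v = (X + Y) / real N + \<delta> * (X - Z)"
      unfolding v \<delta>_def by (intro energy_on_constraint p q c)
    \<comment> \<open>At \<open>X = Y = 0\<close> the balance forces \<open>Z = 0\<close>, so the
      energy would vanish, against its strict positivity.\<close>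
    have "X \<noteq> 0 \<or> Y \<noteq> 0"
    proof (rule ccontr)
      assume *: "\<not> (X \<noteq> 0 \<or> Y \<noteq> 0)"
      then have "Z = 0" using c by auto
      then show False using * E c by simp
    qed
    from H[OF c(1,2,6) this c(7,8,4,5) E] show "ereal T \<le> ereal (energy CARD('n) p q v)"
      by (simp add: assms(1))
  qed
  have "\<forall>\<^sub>F b in at_right 0. ereal (Tp \<mu>) \<le> beta_star TYPE('n) p q a0 \<mu> b" if \<mu>: "0 < \<mu>" for \<mu>
  proof (cases "Sp = 0")
    case True
    then have "Tp \<mu> = 0" by (simp add: Tp_def)
    then show ?thesis by (auto intro!: always_eventually beta_ge)
  next
    case False
    \<comment> \<open>The bound on \<open>Y\<close> that follows from \<open>E < Tp \<mu>\<close>,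
      since \<open>(1 / real N - \<delta>) * Y \<le> E\<close>.\<close>
    define C where "C = Tp \<mu> / (1 / real N - \<delta>)"
    have "\<forall>\<^sub>F b in at_right 0. \<forall>y. 0 < y \<and> y \<le> C \<longrightarrow> L b * y powr (real N / (real N - q)) < y"
      unfolding L_def by (rule eventually_superlinear_less[OF exps(2)]) simp
    then show ?thesis
    proof (rule eventually_mono, intro beta_ge)
      fix b X Y Z W E
      assume small: "\<forall>y. 0 < y \<and> y \<le> C \<longrightarrow> L b * y powr (real N / (real N - q)) < y"
        and c: "0 \<le> X" "0 \<le> Y" "X + Y = Z + W" "X \<noteq> 0 \<or> Y \<noteq> 0"
        "Z \<le> K \<mu> * X powr (real N / (real N - p))" "W \<le> L b * Y powr (real N / (real N - q))"
        "0 \<le> W" and E: "E = (X + Y) / real N + \<delta> * (X - Z)"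
      have "X - Z = W - Y" using c by simp
      \<comment> \<open>In this grouping all coefficients are nonnegative, and \<open>X\<close>
        keeps the sharp factor \<open>1 / real N\<close>.\<close>
      have E': "E = X / real N + (1 / real N - \<delta>) * Y + \<delta> * W"
        unfolding E \<open>X - Z = W - Y\<close> by (simp add: algebra_simps add_divide_distrib)
      have E_ge: "X / real N + (1 / real N - \<delta>) * Y \<le> E" using E' \<delta> c by simp
      show "Tp \<mu> \<le> E"
      proof (rule ccontr)
        assume "\<not> Tp \<mu> \<le> E"
        moreover have "0 \<le> X / real N" using c by simp
        ultimately have "(1 / real N - \<delta>) * Y \<le> Tp \<mu>" using E_ge by linarith
        then have "Y \<le> C" using \<delta> by (simp add: C_def pos_le_divide_eq mult.commute)
        \<comment> \<open>The roles are exchanged: \<open>(Y, W)\<close> is the dominated pair, and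
          \<open>(X, Z)\<close> must carry the energy.\<close>
        then have "0 < X" and "X \<le> K \<mu> * X powr (real N / (real N - p))"
          using dominated_pair[of Y X W Z "L b" "real N / (real N - q)" "K \<mu>" "real N / (real N - p)"] small c by (auto simp: add.commute)
        then have "Sp powr (real N / p) / \<mu> powr ((real N - p) / p) \<le> X"
          unfolding K_def by (intro superlinear_threshold p False \<mu>)
        from mult_left_mono[OF this, of "1 / real N"] have "Tp \<mu> \<le> X / real N" by (simp add: Tp_def)
        moreover have "0 \<le> (1 / real N - \<delta>) * Y" using \<delta> c by simp
        ultimately show False using E_ge \<open>\<not> Tp \<mu> \<le> E\<close> by linarith
      qed
    qed
  qed
  moreover have "\<forall>\<^sub>F \<mu> in at_right 0. ereal (Tq b) \<le> beta_star TYPE('n) p q a0 \<mu> b"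
    if b: "0 < b" for b
  proof (cases "Sq = 0")
    case True
    then have "Tq b = 0" by (simp add: Tq_def)
    then show ?thesis by (auto intro!: always_eventually beta_ge)
  next
    case False
    \<comment> \<open>The bound on \<open>X\<close> that follows from \<open>E < Tq b\<close>, since
      \<open>X / real N \<le> E\<close>.\<close>
    define C where "C = Tq b * real N"
    have "\<forall>\<^sub>F \<mu> in at_right 0. \<forall>y. 0 < y \<and> y \<le> C \<longrightarrow> K \<mu> * y powr (real N / (real N - p)) < y"
      unfolding K_def by (rule eventually_superlinear_less[OF exps(1)]) simp
    then show ?thesis
    proof (rule eventually_mono, intro beta_ge)
      fix \<mu> X Y Z W E
      assume small: "\<forall>y. 0 < y \<and> y \<le> C \<longrightarrow> K \<mu> * y powr (real N / (real N - p)) < y"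
        and c: "0 \<le> X" "0 \<le> Y" "X + Y = Z + W" "X \<noteq> 0 \<or> Y \<noteq> 0"
        "Z \<le> K \<mu> * X powr (real N / (real N - p))" "W \<le> L b * Y powr (real N / (real N - q))"
        "0 \<le> W" and E: "E = (X + Y) / real N + \<delta> * (X - Z)"
      have "X - Z = W - Y" using c by simp
      have E': "E = X / real N + (1 / real N - \<delta>) * Y + \<delta> * W"
        unfolding E \<open>X - Z = W - Y\<close> by (simp add: algebra_simps add_divide_distrib)
      show "Tq b \<le> E"
      proof (rule ccontr)
        assume "\<not> Tq b \<le> E"
        moreover have "X / real N \<le> E" using E' \<delta> c by simp
        ultimately have "X / real N \<le> Tq b" by linarith
        then have "X \<le> C" using N by (simp add: C_def field_simps)
        then have *: "Z \<le> X" "0 < Y" "Y \<le> L b * Y powr (real N / (real N - q))"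
          using dominated_pair[of X Y Z W "K \<mu>" "real N / (real N - p)" "L b" "real N / (real N - q)"] small c by auto
        then have "Sq powr (real N / q) / b powr ((real N - q) / q) \<le> Y"
          unfolding L_def by (intro superlinear_threshold q False b)
        from mult_left_mono[OF this, of "1 / real N"] have "Tq b \<le> Y / real N" by (simp add: Tq_def)
        moreover have "0 \<le> X / real N" "0 \<le> \<delta> * (X - Z)" using \<delta> c * by simp_all
        then have "Y / real N \<le> E" unfolding E add_divide_distrib by linarith
        ultimately show False using \<open>\<not> Tq b \<le> E\<close> by linarith
      qed
    qed
  qed
  \<comment> \<open>The error term \<open>r\<close> is taken to be identically zero.\<close>
  ultimately show ?thesis
    unfolding Tp_def Tq_def Sp_def Sq_def
    by (intro conjI allI impI exI[of _ "\<lambda>_. 0"]) simp_all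
qed

end
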